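(* For every $p\in(0,1)$ and every $\varepsilon>0$, there exists $n_0$ such that for all $n\ge n_0$ there exists a $(p,2\varepsilon,(1,2))$-quasirandom $3$-graph on $n$ vertices in which every subgraph on $m\ge\lfloor\varepsilon^{-1}\rfloor+1$ vertices has minimum codegree equal to zero.
   Context: For a set $A$, $A^{(k)}$ denotes the collection of all $k$-subsets of $A$. A $3$-graph is a pair $G=(V,E)$ with $V=V(G)$ a finite set of vertices and $E=E(G)\subseteq V^{(3)}$; $v(G)=|V(G)|$. A subgraph of $G$ is a $3$-graph $H$ with $V(H)\subseteq V(G)$ and $E(H)\subseteq E(G)$. The minimum codegree of a $3$-graph $H$ is $\delta_2(H)$, the minimum over all pairs $S\in V(H)^{(2)}$ of the number of edges of $H$ containing $S$. A $3$-graph $G$ is $(p,\eta,(1,2))$-quasirandom if for every set of vertices $X\subseteq V(G)$ and every set of pairs $P\subseteq V(G)^{(2)}$, the number $e_{1,2}(X,P)$ of pairs $(x,uv)\in X\times P$ such that $\{x\}\cup\{u,v\}\in E(G)$ satisfies $\left| e_{1,2}(X,P)-p|X|\cdot|P| \right|\le \eta\, v(G)^3$. *)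

theory Defs
  imports Complex_Main "HOL-Library.Ramsey"
begin

type_synonym 'a hypergraph = "'a set \<times> 'a set set"

abbreviation verts :: "'a hypergraph \<Rightarrow> 'a set" where
  "verts G \<equiv> fst G"

abbreviation edges :: "'a hypergraph \<Rightarrow> 'a set set" where
  "edges G \<equiv> snd G"

definition three_graph :: "'a hypergraph \<Rightarrow> bool" where
  "three_graph G \<longleftrightarrow> finite (verts G) \<and> edges G \<subseteq> nsets (verts G) 3"

definition subgraph :: "'a hypergraph \<Rightarrow> 'a hypergraph \<Rightarrow> bool" where
  "subgraph H G \<longleftrightarrow> three_graph H \<and> verts H \<subseteq> verts G \<and> edges H \<subseteq> edges G"

definition codegree :: "'a hypergraph \<Rightarrow> 'a set \<Rightarrow> nat" where
  "codegree H S = card {e \<in> edges H. S \<subseteq> e}"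

(* On fewer than two vertices there is no pair to minimise over; the value is then taken to be 0. *)
definition min_codegree :: "'a hypergraph \<Rightarrow> nat" where
  "min_codegree H =
     (if nsets (verts H) 2 = {} then 0 else Min (codegree H ` nsets (verts H) 2))"

definition e12 :: "'a hypergraph \<Rightarrow> 'a set \<Rightarrow> 'a set set \<Rightarrow> nat" where
  "e12 G X P = card {(x, uv). x \<in> X \<and> uv \<in> P \<and> {x} \<union> uv \<in> edges G}"

definition quasirandom12 :: "real \<Rightarrow> real \<Rightarrow> 'a hypergraph \<Rightarrow> bool" where
  "quasirandom12 p \<eta> G \<longleftrightarrow>
     (\<forall>X P. X \<subseteq> verts G \<longrightarrow> P \<subseteq> nsets (verts G) 2 \<longrightarrow>
        \<bar>real (e12 G X P) - p * real (card X) * real (card P)\<bar> \<le> \<eta> * real (card (verts G)) ^ 3)"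

end

theory Submission
  imports Defs
begin

text \<open>Colour the vertex \<open>v\<close> of \<open>{..<n}\<close> with \<open>v mod k\<close>, where \<open>k\<close> is
  \<open>\<lfloor>1/\<epsilon>\<rfloor>\<close>, raised to 1 if it vanishes, and take as edges a random set of rainbow triples,
  each kept with probability \<open>p\<close>. Among more than \<open>k\<close> vertices two share a colour, and no
  rainbow triple contains both, so every subgraph on that many vertices has a pair of codegree zero
  (\<open>min_codegree_zero_of_rainbow_edges\<close>).

  Forbidding the other triples spoils quasirandomness only a little. For given \<open>X\<close> and \<open>P\<close>,
  split the pairs \<open>(x, uv)\<close> in \<open>X \<times> P\<close> according to whether \<open>{x} \<union> uv\<close> is a
  rainbow triple. On the rainbow part the number of edges is within \<open>o(n\<^sup>3)\<close> of its
  mean, simultaneously for all \<open>X\<close> and \<open>P\<close>: a Chernoff bound gives failure probability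
  \<open>exp (- c n\<^sup>3)\<close>, while there are only \<open>exp (O(n\<^sup>2))\<close> choices of \<open>(X, P)\<close>
  (\<open>exists_low_discrepancy_edge_set\<close>). The rest contributes no edges, hence an error of at most its size.
  A pair \<open>(x, uv)\<close> fails to be rainbow only if one of the three pairs among \<open>x, u, v\<close>
  has equal colours, which happens with frequency about \<open>1/k\<close> for each; out of \<open>n\<^sup>3/2\<close>
  pairs \<open>(x, uv)\<close> this makes about \<open>3n\<^sup>3/(2k)\<close> (\<open>card_non_rainbow_le\<close>). For
  \<open>k \<ge> 3\<close> this is below \<open>2\<epsilon>n\<^sup>3\<close> because \<open>\<epsilon> > 1/(k+1)\<close>, and for
  \<open>k \<le> 2\<close> the trivial bound \<open>n\<^sup>3/2\<close> is already below \<open>2\<epsilon>n\<^sup>3\<close>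
  (\<open>exists_small_non_rainbow_density\<close>).

  The random choice is derandomised by the method of conditional expectations, so that no probability
  space occurs: the triples are decided one after the other, each time in the way that does not
  increase a sum of exponential moments (\<open>exists_subset_small_exp_sum\<close>).\<close>

section \<open>A derandomised Chernoff bound\<close>

lemma exp_le_quadratic:
  fixes x :: real
  assumes "\<bar>x\<bar> \<le> 1"
  shows "exp x \<le> 1 + x + x\<^sup>2"
proof (cases "0 \<le> x")
  case True
  then show ?thesis using assms exp_bound[of x] by auto
next
  case False
  define y where "y = - x"
  have y: "0 \<le> y" "x = - y" using False by (auto simp: y_def)
  have "1 \<le> (1 - y + y\<^sup>2) * (1 + y + y\<^sup>2 / 2)"
  proof -
    have "(1 - y + y\<^sup>2) * (1 + y + y\<^sup>2 / 2) = 1 + y\<^sup>2 / 2 + y ^ 3 / 2 + y ^ 4 / 2"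
      by (simp add: field_simps power2_eq_square power3_eq_cube power4_eq_xxxx)
    then show ?thesis using y(1) by simp
  qed
  also have "\<dots> \<le> (1 - y + y\<^sup>2) * exp y"
  proof (rule mult_left_mono)
    show "1 + y + y\<^sup>2 / 2 \<le> exp y" using exp_lower_Taylor_quadratic[OF y(1)] .
    have "0 \<le> (y - 1/2)\<^sup>2" by simp
    then show "0 \<le> 1 - y + y\<^sup>2" by (simp add: power2_eq_square field_simps)
  qed
  finally show ?thesis by (simp add: y(2) exp_minus field_simps)
qed

text \<open>The moment generating function of a centred Bernoulli variable: in the quadratic bound for the
  exponential the linear terms cancel, and the quadratic ones leave the variance \<open>p(1-p)\<close>.\<close>

lemma bernoulli_mgf_le:
  fixes p t :: real
  assumes "0 \<le> p" "p \<le> 1" "\<bar>t\<bar> \<le> 1"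
  shows "p * exp (t * (1 - p)) + (1 - p) * exp (- (t * p)) \<le> exp (t\<^sup>2)"
proof -
  have a: "\<bar>t * (1 - p)\<bar> \<le> 1" "\<bar>- (t * p)\<bar> \<le> 1"
    using assms by (auto simp: abs_mult intro!: mult_le_one)
  have "p * exp (t * (1 - p)) + (1 - p) * exp (- (t * p))
    \<le> p * (1 + t * (1 - p) + (t * (1 - p))\<^sup>2) + (1 - p) * (1 + (- (t * p)) + (- (t * p))\<^sup>2)"
    using assms by (intro add_mono mult_left_mono exp_le_quadratic a) auto
  also have "\<dots> = 1 + t\<^sup>2 * (p * (1 - p))"
    by (simp add: power2_eq_square algebra_simps)
  also have "\<dots> \<le> 1 + t\<^sup>2 * 1"
    using assms by (intro add_left_mono mult_left_mono mult_le_one) auto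
  also have "\<dots> \<le> exp (t\<^sup>2)" by (simp add: exp_ge_add_one_self)
  finally show ?thesis .
qed

text \<open>For a random \<open>S\<close> containing each element of \<open>T\<close> independently with probability
  \<open>p\<close>, the right-hand side bounds the expectation of the sum. Since the expectation given the
  decisions so far is a \<open>p\<close>-average over the next decision, one of the two ways of deciding a
  new element keeps the sum below its bound. As all terms of the sum are positive, each of them is
  bounded too, which makes this a union bound over \<open>I\<close>.\<close>

lemma exists_subset_small_exp_sum:
  fixes f :: "'i \<Rightarrow> 'e \<Rightarrow> real" and p \<kappa> :: real
  assumes "finite T" "0 \<le> p" "p \<le> 1" "\<kappa> \<le> 1"
    and "\<And>i e. i \<in> I \<Longrightarrow> e \<in> T \<Longrightarrow> \<bar>f i e\<bar> \<le> \<kappa>"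
  shows "\<exists>S\<subseteq>T. (\<Sum>i\<in>I. exp (sum (f i) S - p * sum (f i) T))
           \<le> real (card I) * exp (\<kappa>\<^sup>2 * real (card T))"
  using assms(1,5)
proof (induction T)
  case empty
  then show ?case by simp
next
  case (insert e T)
  then obtain S where S: "S \<subseteq> T"
    "(\<Sum>i\<in>I. exp (sum (f i) S - p * sum (f i) T)) \<le> real (card I) * exp (\<kappa>\<^sup>2 * real (card T))"
    by auto
  define E where "E i = exp (sum (f i) S - p * sum (f i) T)" for i
  define A where "A = (\<Sum>i\<in>I. E i * exp (f i e * (1 - p)))"
  define B where "B = (\<Sum>i\<in>I. E i * exp (- (f i e * p)))"
  have "finite S" "e \<notin> S" using S(1) insert.hyps by (auto intro: finite_subset)
  then have take: "(\<Sum>i\<in>I. exp (sum (f i) (insert e S) - p * sum (f i) (insert e T))) = A"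
    and skip: "(\<Sum>i\<in>I. exp (sum (f i) S - p * sum (f i) (insert e T))) = B"
    using insert.hyps
    by (auto simp: A_def B_def E_def exp_add[symmetric] algebra_simps intro!: sum.cong)
  have "p * A + (1 - p) * B
      = (\<Sum>i\<in>I. E i * (p * exp (f i e * (1 - p)) + (1 - p) * exp (- (f i e * p))))"
    unfolding A_def B_def sum_distrib_left sum.distrib[symmetric]
    by (intro sum.cong) (auto simp: algebra_simps)
  also have "\<dots> \<le> (\<Sum>i\<in>I. E i * exp (\<kappa>\<^sup>2))"
  proof (intro sum_mono mult_left_mono)
    fix i assume "i \<in> I"
    then have f: "\<bar>f i e\<bar> \<le> \<kappa>" using insert.prems by auto
    then have "(f i e)\<^sup>2 \<le> \<kappa>\<^sup>2" by (simp add: abs_le_square_iff[symmetric])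
    with bernoulli_mgf_le[of p "f i e"] f assms(2-4)
    show "p * exp (f i e * (1 - p)) + (1 - p) * exp (- (f i e * p)) \<le> exp (\<kappa>\<^sup>2)"
      by (smt (verit) exp_le_cancel_iff)
    show "0 \<le> E i" by (simp add: E_def)
  qed
  also have "\<dots> \<le> real (card I) * exp (\<kappa>\<^sup>2 * real (card T)) * exp (\<kappa>\<^sup>2)"
    using S(2) unfolding sum_distrib_right[symmetric] E_def by (intro mult_right_mono) auto
  also have "\<dots> = real (card I) * exp (\<kappa>\<^sup>2 * real (card (insert e T)))"
    using insert.hyps by (simp add: exp_add[symmetric] algebra_simps)
  finally have avg: "p * A + (1 - p) * B \<le> real (card I) * exp (\<kappa>\<^sup>2 * real (card (insert e T)))" .
  have "min A B = p * min A B + (1 - p) * min A B" by (simp add: algebra_simps)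
  also have "\<dots> \<le> p * A + (1 - p) * B" using assms by (intro add_mono mult_left_mono) auto
  finally have "min A B \<le> real (card I) * exp (\<kappa>\<^sup>2 * real (card (insert e T)))" using avg by linarith
  then consider (taken) "A \<le> real (card I) * exp (\<kappa>\<^sup>2 * real (card (insert e T)))"
    | (skipped) "B \<le> real (card I) * exp (\<kappa>\<^sup>2 * real (card (insert e T)))" by linarith
  then show ?case
  proof cases
    case taken
    then show ?thesis using take S(1) by (intro exI[of _ "insert e S"]) auto
  next
    case skipped
    then show ?thesis using skip S(1) by (intro exI[of _ S]) auto
  qed
qed

section \<open>Low discrepancy for all vertex sets and pair sets\<close>

text \<open>The set counted by \<open>e12\<close>, with an arbitrary family \<open>S\<close> in place of the edge set, so
  that pairs over a single triple and pairs over no admissible triple are covered as well.\<close>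

definition extensions :: "'a set \<Rightarrow> 'a set set \<Rightarrow> 'a set set \<Rightarrow> ('a \<times> 'a set) set" where
  "extensions X P S = {(x, uv). x \<in> X \<and> uv \<in> P \<and> {x} \<union> uv \<in> S}"

lemma finite_extensions: "finite X \<Longrightarrow> finite P \<Longrightarrow> finite (extensions X P S)"
  by (rule finite_subset[of _ "X \<times> P"]) (auto simp: extensions_def)

lemma card_extensions_eq_sum:
  assumes "finite X" "finite P" "finite S"
  shows "card (extensions X P S) = (\<Sum>e\<in>S. card (extensions X P {e}))"
proof -
  have "extensions X P S = (\<Union>e\<in>S. extensions X P {e})" by (auto simp: extensions_def)
  moreover have "card (\<Union>e\<in>S. extensions X P {e}) = (\<Sum>e\<in>S. card (extensions X P {e}))"
    using assms by (intro card_UN_disjoint) (auto simp: finite_extensions, auto simp: extensions_def)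
  ultimately show ?thesis by simp
qed

text \<open>A triple arises as \<open>{x} \<union> uv\<close> only by choosing which of its elements is \<open>x\<close>.\<close>

lemma card_extensions_singleton_le:
  assumes "P \<subseteq> nsets V 2" "e \<in> nsets V 3"
  shows "card (extensions X P {e}) \<le> 3"
proof -
  have e: "finite e" "card e = 3" using assms(2) by (auto simp: nsets_def)
  have "extensions X P {e} \<subseteq> (\<lambda>x. (x, e - {x})) ` e"
  proof clarify
    fix x uv assume a: "(x, uv) \<in> extensions X P {e}"
    then have "insert x uv = e" "card uv = 2" using assms(1) by (auto simp: extensions_def nsets_def)
    then have "x \<notin> uv" using e by (metis insert_absorb numeral_eq_iff semiring_norm(88))
    then show "(x, uv) \<in> (\<lambda>x. (x, e - {x})) ` e" using \<open>insert x uv = e\<close> by auto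
  qed
  then have "card (extensions X P {e}) \<le> card ((\<lambda>x. (x, e - {x})) ` e)"
    using e by (intro card_mono) auto
  also have "\<dots> \<le> 3" using card_image_le[OF e(1)] e(2) by metis
  finally show ?thesis .
qed

lemma choose_le_power: "n choose k \<le> n ^ k"
  by (cases "k \<le> n") (auto simp: binomial_le_pow binomial_eq_0)

text \<open>The exponential moment bound applies to the functions sending a triple \<open>e\<close> to
  \<open>\<theta> s\<close> times the number of pairs of \<open>X \<times> P\<close> over \<open>e\<close>, with a sign \<open>s\<close> for
  the two tails. Their number is \<open>exp (O(n\<^sup>2))\<close>, and the total exponent
  \<open>O(n\<^sup>2) + 9\<theta>\<^sup>2n\<^sup>3\<close> is less than \<open>\<theta>\<delta>n\<^sup>3\<close> for large \<open>n\<close>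
  once \<open>\<theta>\<close> is small compared with \<open>\<delta>\<close>.\<close>

lemma exists_low_discrepancy_edge_set:
  fixes p \<delta> :: real
  assumes "0 \<le> p" "p \<le> 1" "0 < \<delta>"
  shows "\<exists>n\<^sub>0::nat. \<forall>n\<ge>n\<^sub>0. \<forall>(V :: 'a set) T. finite V \<longrightarrow> card V = n \<longrightarrow> T \<subseteq> nsets V 3 \<longrightarrow>
    (\<exists>S\<subseteq>T. \<forall>X P. X \<subseteq> V \<longrightarrow> P \<subseteq> nsets V 2 \<longrightarrow>
       \<bar>real (card (extensions X P S)) - p * real (card (extensions X P T))\<bar> \<le> \<delta> * real n ^ 3)"
proof -
  \<comment> \<open>The bound \<open>1/3\<close> keeps the exponents \<open>\<theta> s c\<close> with \<open>c \<le> 3\<close> between \<open>-1\<close> and \<open>1\<close>; the bound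
    \<open>\<delta>/18\<close> makes \<open>9\<theta>\<^sup>2\<close> at most \<open>\<theta>\<delta>/2\<close>, leaving the other half of
    \<open>\<theta>\<delta>n\<^sup>3\<close> to absorb the number of functions.\<close>
  define \<theta> where "\<theta> = min (1/3) (\<delta> / 18)"
  have l: "0 < \<theta>" "3 * \<theta> \<le> 1" "18 * \<theta> \<le> \<delta>" using assms by (auto simp: \<theta>_def)
  define n0 where "n0 = Suc (nat \<lceil>6 / (\<theta> * \<delta>)\<rceil>)"
  show ?thesis
  proof (intro exI[of _ n0] allI impI)
    fix n :: nat and V :: "'a set" and T
    assume n: "n0 \<le> n" and V: "finite V" "card V = n" and T: "T \<subseteq> nsets V 3"
    have n1: "1 \<le> n" and n2: "6 / (\<theta> * \<delta>) \<le> real n" using n by (auto simp: n0_def) linarith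
    have finV2: "finite (nsets V 2)" and finT: "finite T"
      using V T by (auto simp: finite_imp_finite_nsets intro: finite_subset)
    define I where "I = Pow V \<times> Pow (nsets V 2) \<times> {1, - 1 :: real}"
    define f where "f = (\<lambda>(X, P, s) e. \<theta> * s * real (card (extensions X P {e} :: ('a \<times> 'a set) set)))"
    have finI: "finite I" using V finV2 by (auto simp: I_def)
    have f_le: "\<bar>f i e\<bar> \<le> 3 * \<theta>" if "i \<in> I" "e \<in> T" for i e
    proof -
      obtain X P s where i: "i = (X, P, s)" by (cases i)
      have "card (extensions X P {e}) \<le> 3" "\<bar>s\<bar> = 1"
        using that T by (auto simp: I_def i intro!: card_extensions_singleton_le)
      then show ?thesis using l by (simp add: f_def i abs_mult)
    qed
    have "\<exists>S\<subseteq>T. (\<Sum>i\<in>I. exp (sum (f i) S - p * sum (f i) T))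
        \<le> real (card I) * exp ((3 * \<theta>)\<^sup>2 * real (card T))"
      by (rule exists_subset_small_exp_sum[OF finT assms(1,2) l(2)]) (rule f_le)
    then obtain S where S: "S \<subseteq> T" and pot:
      "(\<Sum>i\<in>I. exp (sum (f i) S - p * sum (f i) T)) \<le> real (card I) * exp ((3 * \<theta>)\<^sup>2 * real (card T))"
      by (elim exE conjE)
    have cI: "real (card I) \<le> exp (3 * real n ^ 2)"
    proof -
      have "card I = 2 ^ n * (2 ^ (n choose 2) * 2)"
        using V finV2 by (simp add: I_def card_cartesian_product card_Pow card_nsets)
      also have "\<dots> = 2 ^ (n + (n choose 2) + 1)" by (simp add: power_add)
      finally have "real (card I) = 2 ^ (n + (n choose 2) + 1)" by simp
      also have "\<dots> \<le> exp 1 ^ (n + (n choose 2) + 1)"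
        using exp_ge_add_one_self[of 1] by (intro power_mono) auto
      also have "\<dots> = exp (real (n + (n choose 2) + 1))" by (simp only: exp_of_nat_mult[symmetric] mult_1_right)
      also have "\<dots> \<le> exp (3 * real n ^ 2)"
      proof -
        have "n \<le> n ^ 2" "1 \<le> n ^ 2" "n choose 2 \<le> n ^ 2"
          using n1 choose_le_power[of n 2] by (auto simp: power2_eq_square)
        then have "n + (n choose 2) + 1 \<le> 3 * n ^ 2" by linarith
        then have "real (n + (n choose 2) + 1) \<le> real (3 * n ^ 2)" by (rule of_nat_mono)
        then show ?thesis by simp
      qed
      finally show ?thesis .
    qed
    have cT: "real (card T) \<le> real n ^ 3"
    proof -
      have "card T \<le> card (nsets V 3)" using V T by (intro card_mono) (auto simp: finite_imp_finite_nsets)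
      also have "\<dots> \<le> n ^ 3" using V choose_le_power[of n 3] by (simp add: card_nsets)
      finally have "real (card T) \<le> real (n ^ 3)" by (rule of_nat_mono)
      then show ?thesis by simp
    qed
    have "(3 * \<theta>)\<^sup>2 * real (card T) \<le> (\<theta> * \<delta> / 2) * real n ^ 3"
      using l cT by (intro mult_mono) (auto simp: power2_eq_square)
    moreover have "3 * real n ^ 2 \<le> (\<theta> * \<delta> / 2) * real n ^ 3"
    proof -
      have "3 \<le> \<theta> * \<delta> / 2 * real n" using n2 l assms(3) by (simp add: field_simps)
      then have "3 * real n ^ 2 \<le> (\<theta> * \<delta> / 2 * real n) * real n ^ 2" by (intro mult_right_mono) auto
      then show ?thesis by (simp add: power2_eq_square power3_eq_cube algebra_simps)
    qed
    ultimately have expo: "3 * real n ^ 2 + (3 * \<theta>)\<^sup>2 * real (card T) \<le> \<theta> * (\<delta> * real n ^ 3)"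
      by (simp add: algebra_simps)
    have "real (card I) * exp ((3 * \<theta>)\<^sup>2 * real (card T))
        \<le> exp (3 * real n ^ 2) * exp ((3 * \<theta>)\<^sup>2 * real (card T))"
      using cI by (intro mult_right_mono) auto
    also have "\<dots> \<le> exp (\<theta> * (\<delta> * real n ^ 3))" using expo by (simp add: exp_add[symmetric])
    finally have bound: "(\<Sum>i\<in>I. exp (sum (f i) S - p * sum (f i) T)) \<le> exp (\<theta> * (\<delta> * real n ^ 3))"
      using pot by linarith
    have dev: "s * (real (card (extensions X P S)) - p * real (card (extensions X P T))) \<le> \<delta> * real n ^ 3"
      if "X \<subseteq> V" "P \<subseteq> nsets V 2" "s \<in> {1, - 1}" for X P s
    proof -
      have i: "(X, P, s) \<in> I" using that by (auto simp: I_def)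
      have fin: "finite X" "finite P" "finite S"
        using that V finV2 finT S by (auto intro: finite_subset)
      have sums: "sum (f (X, P, s)) U = \<theta> * s * real (card (extensions X P U))" if "finite U" for U
        using card_extensions_eq_sum[OF fin(1,2) that] by (simp add: f_def sum_distrib_left)
      have "exp (sum (f (X, P, s)) S - p * sum (f (X, P, s)) T) \<le> exp (\<theta> * (\<delta> * real n ^ 3))"
        by (rule order_trans[OF member_le_sum[OF i _ finI] bound]) simp
      then have "\<theta> * (s * (real (card (extensions X P S)) - p * real (card (extensions X P T))))
          \<le> \<theta> * (\<delta> * real n ^ 3)"
        by (simp add: sums fin finT algebra_simps)
      then show ?thesis using l by simp
    qed
    show "\<exists>S\<subseteq>T. \<forall>X P. X \<subseteq> V \<longrightarrow> P \<subseteq> nsets V 2 \<longrightarrow>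
       \<bar>real (card (extensions X P S)) - p * real (card (extensions X P T))\<bar> \<le> \<delta> * real n ^ 3"
    proof (intro exI[of _ S] conjI S allI impI)
      fix X P assume "X \<subseteq> V" "P \<subseteq> nsets V 2"
      from dev[OF this, of 1] dev[OF this, of "-1"]
      show "\<bar>real (card (extensions X P S)) - p * real (card (extensions X P T))\<bar> \<le> \<delta> * real n ^ 3"
        by simp
    qed
  qed
qed

section \<open>Counting non-rainbow pairs\<close>

definition rainbow_triples :: "nat \<Rightarrow> nat \<Rightarrow> nat set set" where
  "rainbow_triples n k = {e \<in> nsets {..<n} 3. inj_on (\<lambda>v. v mod k) e}"

lemma inj_on_div_residue_class:
  fixes k r :: nat
  shows "inj_on (\<lambda>x. x div k) {x. x mod k = r}"
  by (rule inj_onI, drule CollectD, drule CollectD) (metis div_mult_mod_eq)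

lemma card_residue_class_le:
  fixes n k r :: nat
  shows "card {x. x < n \<and> x mod k = r} \<le> n div k + 1"
proof -
  have "card {x. x < n \<and> x mod k = r} \<le> card {..n div k}"
    by (rule card_inj_on_le[OF inj_on_subset[OF inj_on_div_residue_class[of k r]]])
       (auto intro: div_le_mono)
  then show ?thesis by simp
qed

text \<open>Counting each congruent pair from its larger element gives \<open>v div k\<close> without an additive error,
  so the monochromatic pairs sum up to at most \<open>n\<^sup>2/(2k)\<close>.\<close>

lemma card_smaller_congruent_le:
  fixes v k :: nat
  assumes "0 < k"
  shows "card {u. u < v \<and> u mod k = v mod k} \<le> v div k"
proof -
  have "card {u. u < v \<and> u mod k = v mod k} \<le> card {..<v div k}"
  proof (rule card_inj_on_le[OF inj_on_subset[OF inj_on_div_residue_class[of k "v mod k"]]])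
    have "u div k < v div k" if "u < v" "u mod k = v mod k" for u
    proof -
      have "u div k \<noteq> v div k" using that div_mult_mod_eq[of u k] div_mult_mod_eq[of v k] by auto
      then show ?thesis using div_le_mono[of u v k] that(1) by simp
    qed
    then show "(\<lambda>x. x div k) ` {u. u < v \<and> u mod k = v mod k} \<subseteq> {..<v div k}" by auto
  qed auto
  then show ?thesis by simp
qed

lemma card_nsets_2_le: "real (card (nsets {..<n} 2)) \<le> real n ^ 2 / 2" for n :: nat
proof -
  have "2 * (n choose 2) \<le> n * (n - 1)" unfolding choose_two by simp
  also have "\<dots> \<le> n * n" by (intro mult_left_mono) auto
  finally have "2 * (n choose 2) \<le> n * n" .
  then have "real (2 * (n choose 2)) \<le> real (n * n)" by (rule of_nat_mono)
  then show ?thesis by (simp add: card_nsets power2_eq_square)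
qed

lemma card_congruent_pairs_le:
  fixes n k :: nat
  assumes "0 < k"
  shows "real (card {uv \<in> nsets {..<n} 2. \<not> inj_on (\<lambda>v. v mod k) uv}) \<le> real n ^ 2 / (2 * real k)"
    (is "real (card ?M) \<le> _")
proof -
  define L where "L v = {u. u < v \<and> u mod k = v mod k}" for v
  have finL: "finite (L v)" for v by (simp add: L_def)
  have "?M \<subseteq> (\<Union>v<n. (\<lambda>u. {u, v}) ` L v)"
  proof
    fix uv assume uv: "uv \<in> ?M"
    then obtain a b where "a \<in> uv" "b \<in> uv" "a mod k = b mod k" "a \<noteq> b" by (auto simp: inj_on_def)
    then obtain u v where u: "u \<in> uv" "v \<in> uv" "u mod k = v mod k" "u < v" by (metis nat_neq_iff)
    moreover from uv have "finite uv" "card uv = 2" "uv \<subseteq> {..<n}" by (auto simp: nsets_def)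
    ultimately have "uv = {u, v}" by (intro card_seteq[symmetric]) auto
    then show "uv \<in> (\<Union>v<n. (\<lambda>u. {u, v}) ` L v)" using u \<open>uv \<subseteq> {..<n}\<close> by (auto simp: L_def)
  qed
  then have "card ?M \<le> card (\<Union>v<n. (\<lambda>u. {u, v}) ` L v)" by (intro card_mono) (auto simp: finL)
  also have "\<dots> \<le> (\<Sum>v<n. card ((\<lambda>u. {u, v}) ` L v))" by (rule card_UN_le) simp
  also have "\<dots> \<le> (\<Sum>v<n. v div k)"
  proof (rule sum_mono)
    fix v
    have "card ((\<lambda>u. {u, v}) ` L v) \<le> card (L v)" by (rule card_image_le[OF finL])
    also have "\<dots> \<le> v div k" unfolding L_def by (rule card_smaller_congruent_le[OF assms])
    finally show "card ((\<lambda>u. {u, v}) ` L v) \<le> v div k" .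
  qed
  finally have "real (card ?M) \<le> (\<Sum>v<n. real (v div k))" by (simp flip: of_nat_sum)
  also have "\<dots> \<le> (\<Sum>v<n. real v / real k)" by (intro sum_mono of_nat_div_le_of_nat)
  also have "\<dots> = (\<Sum>v<n. real v) / real k" by (simp add: sum_divide_distrib)
  also have "\<dots> \<le> (real n ^ 2 / 2) / real k"
  proof (rule divide_right_mono)
    show "(\<Sum>v<n. real v) \<le> real n ^ 2 / 2"
      by (induction n) (auto simp: power2_eq_square field_simps)
  qed simp
  finally show ?thesis by simp
qed

text \<open>For the second bound, a non-rainbow \<open>(x, uv)\<close> either has a monochromatic \<open>uv\<close>, with
  \<open>x\<close> arbitrary, or \<open>x\<close> lies in the colour class of \<open>u\<close> or \<open>v\<close>. The latter case
  includes the degenerate pairs with \<open>x \<in> uv\<close>. The quadratic term comes from rounding up the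
  sizes of the colour classes.\<close>

lemma card_non_rainbow_le:
  fixes n k :: nat
  assumes "0 < k"
  defines "B \<equiv> extensions {..<n} (nsets {..<n} 2) (- rainbow_triples n k)"
  shows "real (card B) \<le> real n ^ 3 / 2"
    and "real (card B) \<le> 3 / (2 * real k) * real n ^ 3 + real n ^ 2"
proof -
  have fin2: "finite (nsets {..<n} 2)" by (simp add: finite_imp_finite_nsets)
  have "card B \<le> card ({..<n} \<times> nsets {..<n} 2)"
    using fin2 by (intro card_mono) (auto simp: B_def extensions_def)
  also have "\<dots> = n * card (nsets {..<n} 2)" by (simp add: card_cartesian_product)
  finally have "real (card B) \<le> real (n * card (nsets {..<n} 2))" by (rule of_nat_mono)
  also have "\<dots> = real n * real (card (nsets {..<n} 2))" by simp
  also have "\<dots> \<le> real n * (real n ^ 2 / 2)" by (intro mult_left_mono card_nsets_2_le) simp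
  finally show "real (card B) \<le> real n ^ 3 / 2" by (simp add: power2_eq_square power3_eq_cube)
next
  define M where "M = {uv \<in> nsets {..<n} 2. \<not> inj_on (\<lambda>v. v mod k) uv}"
  define R where "R uv = (\<Union>u\<in>uv. {x. x < n \<and> x mod k = u mod k})" for uv
  have fin2: "finite (nsets {..<n} 2)" and finM: "finite M"
    by (simp_all add: finite_imp_finite_nsets M_def)
  have finR: "finite (R uv)" if "uv \<in> nsets {..<n} 2" for uv
    using that by (auto simp: R_def nsets_def)
  have cR: "card (R uv) \<le> 2 * (n div k + 1)" if uv: "uv \<in> nsets {..<n} 2" for uv
  proof -
    have "finite uv" "card uv = 2" using uv by (auto simp: nsets_def)
    then have "card (R uv) \<le> (\<Sum>u\<in>uv. card {x. x < n \<and> x mod k = u mod k})"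
      unfolding R_def by (intro card_UN_le)
    also have "\<dots> \<le> (\<Sum>u\<in>uv. n div k + 1)" by (intro sum_mono card_residue_class_le)
    finally show ?thesis using \<open>card uv = 2\<close> by simp
  qed
  have sub: "B \<subseteq> {..<n} \<times> M \<union> (\<lambda>(uv, x). (x, uv)) ` Sigma (nsets {..<n} 2) R"
  proof (rule subrelI)
    fix x uv assume b: "(x, uv) \<in> B"
    have x: "x < n" and uv: "uv \<in> nsets {..<n} 2" and nr: "insert x uv \<notin> rainbow_triples n k"
      using b by (auto simp: B_def extensions_def)
    show "(x, uv) \<in> {..<n} \<times> M \<union> (\<lambda>(uv, x). (x, uv)) ` Sigma (nsets {..<n} 2) R"
    proof (cases "x \<in> R uv")
      case True
      then show ?thesis using uv by force
    next
      case False
      then have *: "x mod k \<noteq> u mod k" if "u \<in> uv" for u using that x by (auto simp: R_def)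
      then have "x \<notin> uv" by blast
      then have "insert x uv \<in> nsets {..<n} 3" using uv x by (auto simp: nsets_def)
      then have "\<not> inj_on (\<lambda>v. v mod k) (insert x uv)" using nr by (simp add: rainbow_triples_def)
      then have "\<not> inj_on (\<lambda>v. v mod k) uv" using * by auto
      then show ?thesis using x uv by (auto simp: M_def)
    qed
  qed
  have finS: "finite (Sigma (nsets {..<n} 2) R)" using fin2 finR by (rule finite_SigmaI)
  have "card B \<le> card ({..<n} \<times> M \<union> (\<lambda>(uv, x). (x, uv)) ` Sigma (nsets {..<n} 2) R)"
    using sub finM finS by (intro card_mono) auto
  also have "\<dots> \<le> card ({..<n} \<times> M) + card (Sigma (nsets {..<n} 2) R)"
    using card_Un_le card_image_le[OF finS] by (meson add_left_mono le_trans)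
  also have "\<dots> \<le> n * card M + card (nsets {..<n} 2) * (2 * (n div k + 1))"
    using fin2 finR sum_bounded_above[of "nsets {..<n} 2" "\<lambda>uv. card (R uv)", OF cR]
    by (simp add: card_cartesian_product)
  finally have "real (card B) \<le> real (n * card M + card (nsets {..<n} 2) * (2 * (n div k + 1)))"
    by (rule of_nat_mono)
  also have "\<dots> = real n * real (card M) + real (card (nsets {..<n} 2)) * (2 * (real (n div k) + 1))"
    by (simp add: algebra_simps)
  also have "\<dots> \<le> real n * (real n ^ 2 / (2 * real k)) + (real n ^ 2 / 2) * (2 * (real n / real k + 1))"
    using card_congruent_pairs_le[OF assms(1), of n] card_nsets_2_le[of n]
    by (intro add_mono mult_mono mult_left_mono of_nat_div_le_of_nat) (auto simp: M_def)
  also have "\<dots> = 3 / (2 * real k) * real n ^ 3 + real n ^ 2"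
    using assms(1) by (simp add: field_simps power2_eq_square power3_eq_cube)
  finally show "real (card B) \<le> 3 / (2 * real k) * real n ^ 3 + real n ^ 2" .
qed

text \<open>Both cases rest on \<open>\<epsilon> > 1/(k+1)\<close>. For \<open>k \<ge> 3\<close> one has
  \<open>3/(2k) \<le> 2/(k+1)\<close>, with equality at \<open>k = 3\<close>; for \<open>k \<le> 2\<close> this inequality
  fails, but then \<open>2\<epsilon> > 2/3 > 1/2\<close>.\<close>

lemma exists_small_non_rainbow_density:
  fixes \<epsilon> :: real
  assumes "0 < \<epsilon>"
  defines "k \<equiv> max 1 (nat \<lfloor>inverse \<epsilon>\<rfloor>)"
  shows "\<exists>\<beta><2 * \<epsilon>. \<forall>n. real (card (extensions {..<n} (nsets {..<n} 2) (- rainbow_triples n k)))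
           \<le> \<beta> * real n ^ 3 + real n ^ 2"
proof -
  have k: "0 < k" by (simp add: k_def)
  have "inverse \<epsilon> < real k + 1" unfolding k_def by linarith
  then have e: "1 / (real k + 1) < \<epsilon>" using assms(1) k by (simp add: field_simps)
  show ?thesis
  proof (cases "k \<le> 2")
    case True
    then have "1 / 3 \<le> 1 / (real k + 1)" by (simp add: field_simps)
    then have "1 / 2 < 2 * \<epsilon>" using e by linarith
    moreover have "real (card (extensions {..<n} (nsets {..<n} 2) (- rainbow_triples n k)))
           \<le> 1 / 2 * real n ^ 3 + real n ^ 2" for n
      using card_non_rainbow_le(1)[OF k, of n] zero_le_power2[of "real n"] by linarith
    ultimately show ?thesis by blast
  next
    case False
    then have "3 / (2 * real k) \<le> 2 * (1 / (real k + 1))" by (simp add: field_simps)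
    then have "3 / (2 * real k) < 2 * \<epsilon>" using e by linarith
    then show ?thesis using card_non_rainbow_le(2)[OF k] by blast
  qed
qed

section \<open>Vanishing codegrees and the theorem\<close>

lemma min_codegree_zero_of_rainbow_edges:
  assumes H: "three_graph H" and sub: "edges H \<subseteq> rainbow_triples n k"
    and k: "0 < k" "k < card (verts H)"
  shows "min_codegree H = 0"
proof -
  have fin: "finite (verts H)" using H by (simp add: three_graph_def)
  have "card ((\<lambda>v. v mod k) ` verts H) \<le> card {..<k}" using k by (intro card_mono) auto
  then have "\<not> inj_on (\<lambda>v. v mod k) (verts H)" using k(2) pigeonhole[of "\<lambda>v. v mod k" "verts H"] by auto
  then obtain u v where uv: "u \<in> verts H" "v \<in> verts H" "u \<noteq> v" "u mod k = v mod k"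
    by (auto simp: inj_on_def)
  have mem: "{u, v} \<in> nsets (verts H) 2" using uv by (auto simp: nsets_def)
  have "{e \<in> edges H. {u, v} \<subseteq> e} = {}"
    using sub uv by (auto simp: rainbow_triples_def inj_on_def dest!: subsetD)
  then have "codegree H {u, v} = 0" unfolding codegree_def by (metis card.empty)
  then have "Min (codegree H ` nsets (verts H) 2) \<le> 0"
    using Min_le[of "codegree H ` nsets (verts H) 2" "codegree H {u, v}"] mem fin
    by (auto simp: finite_imp_finite_nsets)
  then show ?thesis by (simp add: min_codegree_def)
qed

theorem proposition7:
  fixes p \<epsilon> :: real
  assumes "0 < p" and "p < 1" and "0 < \<epsilon>"
  shows "\<exists>n\<^sub>0::nat. \<forall>n\<ge>n\<^sub>0. \<exists>G :: nat hypergraph.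
           three_graph G \<and> card (verts G) = n \<and> quasirandom12 p (2 * \<epsilon>) G \<and>
           (\<forall>H. subgraph H G \<and> int (card (verts H)) \<ge> \<lfloor>inverse \<epsilon>\<rfloor> + 1 \<longrightarrow> min_codegree H = 0)"
proof -
  define k where "k = max 1 (nat \<lfloor>inverse \<epsilon>\<rfloor>)"
  have k: "0 < k" by (simp add: k_def)
  obtain \<beta> where \<beta>: "\<beta> < 2 * \<epsilon>" and bad: "\<And>n. real (card (extensions {..<n} (nsets {..<n} 2)
      (- rainbow_triples n k))) \<le> \<beta> * real n ^ 3 + real n ^ 2"
    using exists_small_non_rainbow_density[OF assms(3)] unfolding k_def by blast
  \<comment> \<open>Half of the slack pays for the discrepancy, the other half for the quadratic term of the
    non-rainbow count.\<close>
  define \<delta> where "\<delta> = (2 * \<epsilon> - \<beta>) / 2"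
  have \<delta>: "0 < \<delta>" using \<beta> by (simp add: \<delta>_def)
  from exists_low_discrepancy_edge_set[of p \<delta>, where ?'a = nat] assms \<delta>
  obtain n1 where n1: "\<And>n V T. n1 \<le> n \<Longrightarrow> finite (V :: nat set) \<Longrightarrow> card V = n \<Longrightarrow> T \<subseteq> nsets V 3 \<Longrightarrow>
    \<exists>S\<subseteq>T. \<forall>X P. X \<subseteq> V \<longrightarrow> P \<subseteq> nsets V 2 \<longrightarrow>
       \<bar>real (card (extensions X P S)) - p * real (card (extensions X P T))\<bar> \<le> \<delta> * real n ^ 3"
    by (metis less_imp_le)
  show ?thesis
  proof (intro exI[of _ "max n1 (nat \<lceil>1 / \<delta>\<rceil>)"] allI impI)
    fix n assume n: "max n1 (nat \<lceil>1 / \<delta>\<rceil>) \<le> n"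
    define V where "V = {..<n}"
    define T where "T = rainbow_triples n k"
    have V: "finite V" "card V = n" and T: "T \<subseteq> nsets V 3"
      by (auto simp: V_def T_def rainbow_triples_def)
    from n1[of n V T] V T n obtain S where S: "S \<subseteq> T" and dev: "\<And>X P. X \<subseteq> V \<Longrightarrow> P \<subseteq> nsets V 2 \<Longrightarrow>
       \<bar>real (card (extensions X P S)) - p * real (card (extensions X P T))\<bar> \<le> \<delta> * real n ^ 3"
      by auto
    have "1 \<le> \<delta> * real n" using n \<delta> by (simp add: field_simps)
    then have "1 * real n ^ 2 \<le> \<delta> * real n * real n ^ 2" by (intro mult_right_mono) auto
    then have n2: "real n ^ 2 \<le> \<delta> * real n ^ 3" by (simp add: power2_eq_square power3_eq_cube algebra_simps)
    have "quasirandom12 p (2 * \<epsilon>) (V, S)"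
      unfolding quasirandom12_def
    proof (intro allI impI)
      fix X P assume XP: "X \<subseteq> verts (V, S)" "P \<subseteq> nsets (verts (V, S)) 2"
      then have fin: "finite X" "finite P"
        using V by (auto intro: finite_subset simp: finite_imp_finite_nsets)
      have "X \<times> P = extensions X P T \<union> extensions X P (- T)" by (auto simp: extensions_def)
      moreover have "extensions X P T \<inter> extensions X P (- T) = {}" by (auto simp: extensions_def)
      ultimately have "card (X \<times> P) = card (extensions X P T) + card (extensions X P (- T))"
        using fin by (metis card_Un_disjoint finite_extensions)
      then have split: "real (card X) * real (card P)
          = real (card (extensions X P T)) + real (card (extensions X P (- T)))"
        by (simp add: card_cartesian_product flip: of_nat_mult of_nat_add)
      have "card (extensions X P (- T)) \<le> card (extensions V (nsets V 2) (- T))"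
        using XP V by (intro card_mono finite_extensions finite_imp_finite_nsets)
          (auto simp: extensions_def)
      then have B: "real (card (extensions X P (- T))) \<le> \<beta> * real n ^ 3 + \<delta> * real n ^ 3"
        using bad[of n] n2 unfolding V_def T_def by linarith
      have pB: "0 \<le> p * real (card (extensions X P (- T)))"
        "p * real (card (extensions X P (- T))) \<le> real (card (extensions X P (- T)))"
        using assms by (auto simp: mult_left_le_one_le)
      have "real (e12 (V, S) X P) - p * real (card X) * real (card P)
          = (real (card (extensions X P S)) - p * real (card (extensions X P T)))
            - p * real (card (extensions X P (- T)))"
        using split by (simp add: e12_def extensions_def mult.assoc distrib_left)
      moreover have "\<beta> * real n ^ 3 + \<delta> * real n ^ 3 + \<delta> * real n ^ 3 = 2 * \<epsilon> * real n ^ 3"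
        by (simp add: \<delta>_def field_simps)
      ultimately show "\<bar>real (e12 (V, S) X P) - p * real (card X) * real (card P)\<bar>
          \<le> 2 * \<epsilon> * real (card (verts (V, S))) ^ 3"
        using dev[of X P] XP B pB V by auto
    qed
    moreover have "three_graph (V, S)" using V S T by (auto simp: three_graph_def)
    moreover have "min_codegree H = 0"
      if H: "subgraph H (V, S)" "\<lfloor>inverse \<epsilon>\<rfloor> + 1 \<le> int (card (verts H))" for H
    \<comment> \<open>If \<open>\<epsilon> > 1\<close>, then \<open>H\<close> may be smaller than \<open>k + 1 = 2\<close>; having no pair
      of vertices, it then has minimum codegree zero by convention.\<close>
    proof (cases "card (verts H) \<le> 1")
      case True
      then have "nsets (verts H) 2 = {}"
        using H(1) by (simp add: nsets_eq_empty_iff subgraph_def three_graph_def)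
      then show ?thesis by (simp add: min_codegree_def)
    next
      case False
      then have "k < card (verts H)" using H(2) by (auto simp: k_def)
      then show ?thesis
        using min_codegree_zero_of_rainbow_edges[of H n k] H(1) S k
        by (auto simp: subgraph_def T_def)
    qed
    ultimately show "\<exists>G :: nat hypergraph.
           three_graph G \<and> card (verts G) = n \<and> quasirandom12 p (2 * \<epsilon>) G \<and>
           (\<forall>H. subgraph H G \<and> int (card (verts H)) \<ge> \<lfloor>inverse \<epsilon>\<rfloor> + 1 \<longrightarrow> min_codegree H = 0)"
      using V by (intro exI[of _ "(V, S)"]) auto
  qed
qed

end
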